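(* If $(K_n)_{n\in\omega}$ is a sequence of nonmetrizable Eberlein compact spaces, then the product $\prod_{n\in\omega}K_n$ is not hereditarily metacompact.
   Context: All topological spaces are assumed to be completely regular Hausdorff (Tikhonov). A compact space is Eberlein compact if it is homeomorphic to a weakly compact subset of a Banach space. A space is metacompact if every open cover has a point-finite open refinement (covering the space), where a family is point-finite if every point belongs to only finitely many of its members; a space is hereditarily metacompact if every subspace is metacompact. *)

theory Defs
  imports "HOL-Analysis.Analysis"
begin

section \<open>Metacompactness\<close>

definition metacompact_space :: "'a topology \<Rightarrow> bool" where
  "metacompact_space X \<longleftrightarrow>
     (\<forall>\<U>. (\<forall>U\<in>\<U>. openin X U) \<and> \<Union>\<U> = topspace X \<longrightarrow>
        (\<exists>\<V>. (\<forall>V\<in>\<V>. openin X V) \<and> \<Union>\<V> = topspace X \<and>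
             (\<forall>V\<in>\<V>. \<exists>U\<in>\<U>. V \<subseteq> U) \<and>
             (\<forall>x\<in>topspace X. finite {V \<in> \<V>. x \<in> V})))"

definition hereditarily_metacompact :: "'a topology \<Rightarrow> bool" where
  "hereditarily_metacompact X \<longleftrightarrow>
     (\<forall>S. S \<subseteq> topspace X \<longrightarrow> metacompact_space (subtopology X S))"


section \<open>Banach spaces on a carrier and their weak topologies\<close>

text \<open>
  A sequence of Banach spaces need not share one type of class \<open>banach\<close>.  A Banach space is
  therefore given here by a linear subspace \<open>V\<close> of a real vector space type, together with a norm
  \<open>N\<close> on \<open>V\<close>; the values of \<open>N\<close> outside \<open>V\<close> are irrelevant.  No topology or norm on the ambient
  type is involved.  The lemmas \<open>banach_on_UNIV\<close> and \<open>dual_on_UNIV\<close> relate this to the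
  type class.
\<close>

definition norm_on :: "'b::real_vector set \<Rightarrow> ('b \<Rightarrow> real) \<Rightarrow> bool" where
  "norm_on V N \<longleftrightarrow> subspace V \<and>
     (\<forall>x\<in>V. 0 \<le> N x \<and> (N x = 0 \<longleftrightarrow> x = 0)) \<and>
     (\<forall>x\<in>V. \<forall>y\<in>V. N (x + y) \<le> N x + N y) \<and>
     (\<forall>c. \<forall>x\<in>V. N (c *\<^sub>R x) = \<bar>c\<bar> * N x)"

definition banach_on :: "'b::real_vector set \<Rightarrow> ('b \<Rightarrow> real) \<Rightarrow> bool" where
  "banach_on V N \<longleftrightarrow> norm_on V N \<and>
     (\<forall>s::nat \<Rightarrow> 'b. (\<forall>n. s n \<in> V) \<and>
          (\<forall>e>0. \<exists>M. \<forall>m\<ge>M. \<forall>n\<ge>M. N (s m - s n) < e) \<longrightarrow>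
        (\<exists>l\<in>V. (\<lambda>n. N (s n - l)) \<longlonglongrightarrow> 0))"

definition dual_on :: "'b::real_vector set \<Rightarrow> ('b \<Rightarrow> real) \<Rightarrow> ('b \<Rightarrow> real) set" where
  "dual_on V N = {f.
     (\<forall>x\<in>V. \<forall>y\<in>V. f (x + y) = f x + f y) \<and>
     (\<forall>c. \<forall>x\<in>V. f (c *\<^sub>R x) = c * f x) \<and>
     (\<exists>B. \<forall>x\<in>V. \<bar>f x\<bar> \<le> B * N x)}"

definition weak_topology_on :: "'b::real_vector set \<Rightarrow> ('b \<Rightarrow> real) \<Rightarrow> 'b topology" where
  "weak_topology_on V N =
     topology_generated_by {{x \<in> V. f x \<in> U} | f U. f \<in> dual_on V N \<and> open U}"

lemma banach_on_UNIV: "banach_on (UNIV :: 'b::banach set) norm"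
  unfolding banach_on_def
proof (intro conjI allI impI)
  show "norm_on (UNIV :: 'b set) norm"
    by (simp add: norm_on_def norm_triangle_ineq)
next
  fix s :: "nat \<Rightarrow> 'b"
  assume "(\<forall>n. s n \<in> UNIV) \<and> (\<forall>e>0. \<exists>M. \<forall>m\<ge>M. \<forall>n\<ge>M. norm (s m - s n) < e)"
  then have "Cauchy s"
    by (simp add: Cauchy_iff)
  then obtain l where "s \<longlonglongrightarrow> l"
    using Cauchy_convergent convergentD by blast
  then show "\<exists>l\<in>UNIV. (\<lambda>n. norm (s n - l)) \<longlonglongrightarrow> 0"
    using LIM_zero tendsto_norm_zero by blast
qed

lemma dual_on_UNIV:
  "dual_on (UNIV :: 'b::real_normed_vector set) norm = {f. bounded_linear f}"
  by (auto simp: dual_on_def bounded_linear_def linear_iff bounded_linear_axioms_def mult.commute)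

lemma topspace_weak_topology_on [simp]: "topspace (weak_topology_on V N) = V"
proof -
  have "(\<lambda>x. 0) \<in> dual_on V N"
    by (auto simp: dual_on_def intro: exI[of _ 0])
  then have "V \<in> {{x \<in> V. f x \<in> U} | f U. f \<in> dual_on V N \<and> open U}"
    by (auto intro!: exI[of _ "\<lambda>x. 0"] exI[of _ "UNIV :: real set"])
  then show ?thesis
    unfolding weak_topology_on_def topology_generated_by_topspace by auto
qed


section \<open>Eberlein compact spaces\<close>

text \<open>
  HOL cannot quantify over types inside a formula, so the type from which the Banach space is
  taken is a parameter.  In a theorem that assumes \<open>Eberlein_compact TYPE('b) X\<close> for a type
  variable \<open>'b\<close>, the Banach space is arbitrary.  Several spaces may have different witnesses
  \<open>(V, N)\<close> over the same \<open>'b\<close>; any sequence of Banach spaces can be copied into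
  a single vector space type, for instance the direct sum of the underlying vector spaces.
\<close>

definition Eberlein_compact :: "'b::real_vector itself \<Rightarrow> 'a topology \<Rightarrow> bool" where
  "Eberlein_compact (_ :: 'b itself) X \<longleftrightarrow>
     (\<exists>(V :: 'b set) N C. banach_on V N \<and> compactin (weak_topology_on V N) C \<and>
        X homeomorphic_space subtopology (weak_topology_on V N) C)"

end

theory Submission
  imports Defs
begin

text \<open>
  A nonmetrizable Eberlein compact space has an uncountable discrete subset: for a point \<open>v\<close>
  and a bound \<open>k\<close>, take a maximal family of pairs \<open>(x, f)\<close> with \<open>x\<close> in the weakly compact set
  \<open>C\<close>, \<open>f\<close> a functional of norm at most \<open>k\<close>, \<open>f v = 0\<close> and \<open>f x = 1\<close>, such that \<open>f\<close> is small at
  the other points of the family.  If all these families were countable, a countable set \<open>D\<close> closed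
  under enough operations would have as norm closure a subspace \<open>M\<close> such that every \<open>x \<in> C\<close> agrees, on
  the functionals of the families indexed by \<open>D\<close>, with some \<open>y \<in> C \<inter> M\<close>.  For \<open>x \<in> C - M\<close>, a
  functional that vanishes on \<open>M\<close> but not at \<open>x\<close> then enlarges the family of a point \<open>v \<in> D\<close>
  close to \<open>y\<close>.  So \<open>C \<subseteq> M\<close>, which makes \<open>C\<close> metrizable.

  Let \<open>D n\<close> be uncountable and discrete in \<open>K n\<close>, with closure \<open>L n\<close>.  The points of \<open>\<Prod>\<^sub>n L n\<close> with
  some coordinate \<open>n\<close> in \<open>D n\<close> are covered by the sets \<open>U n d = {x. x n = d}\<close>.  A point-finite open
  refinement contains, by compactness, the part of \<open>U n d\<close> that avoids a finite set \<open>F n d\<close> of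
  isolated coordinate values.  A sequence \<open>t\<close> with \<open>t n \<in> D n\<close> that is free for \<open>F\<close> then lies in
  infinitely many members of the refinement.
\<close>

section \<open>The Hahn-Banach theorem\<close>

definition sublinear_functional :: "('b::real_vector \<Rightarrow> real) \<Rightarrow> bool" where
  "sublinear_functional p \<longleftrightarrow>
     (\<forall>x y. p (x + y) \<le> p x + p y) \<and> (\<forall>c x. 0 \<le> c \<longrightarrow> p (c *\<^sub>R x) = c * p x)"

lemma sublinear_functional_add: "sublinear_functional p \<Longrightarrow> p (x + y) \<le> p x + p y"
  by (simp add: sublinear_functional_def)

lemma sublinear_functional_scale: "sublinear_functional p \<Longrightarrow> 0 \<le> c \<Longrightarrow> p (c *\<^sub>R x) = c * p x"
  by (simp add: sublinear_functional_def)

lemma sublinear_functional_zero: "sublinear_functional p \<Longrightarrow> p 0 = 0"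
  using sublinear_functional_scale[of p 0 0] by simp

lemma sublinear_functional_minus: "sublinear_functional p \<Longrightarrow> - p (- x) \<le> p x"
  using sublinear_functional_add[of p x "- x"] sublinear_functional_zero[of p] by simp

text \<open>Three constructions below are infima of this kind: tightening along a ray, the lower
  bound of a chain, and the distance to a subspace. Inequalities suffice as hypotheses, because the
  scaling inequality for \<open>inverse c\<close> turns the one for \<open>c\<close> into an
  equality.\<close>

lemma sublinear_functional_INF:
  assumes ne: "I \<noteq> {}" and bdd: "\<And>x. bdd_below ((\<lambda>i. h i x) ` I)"
    and add: "\<And>x y i j. i \<in> I \<Longrightarrow> j \<in> I \<Longrightarrow> \<exists>k\<in>I. h k (x + y) \<le> h i x + h j y"
    and scale: "\<And>c x i. 0 < c \<Longrightarrow> i \<in> I \<Longrightarrow> \<exists>k\<in>I. h k (c *\<^sub>R x) \<le> c * h i x"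
    and zero: "\<And>i. i \<in> I \<Longrightarrow> 0 \<le> h i 0" "\<And>e. 0 < e \<Longrightarrow> \<exists>i\<in>I. h i 0 < e"
  shows "sublinear_functional (\<lambda>x::'b::real_vector. INF i\<in>I. h i x :: real)"
proof -
  let ?q = "\<lambda>x. INF i\<in>I. h i x"
  have lower: "?q x \<le> h i x" if "i \<in> I" for i x
    using bdd that by (rule cINF_lower)
  have sub: "?q (x + y) \<le> ?q x + ?q y" for x y
  proof -
    have "?q (x + y) \<le> h i x + h j y" if "i \<in> I" "j \<in> I" for i j
      using add[OF that, of x y] lower order_trans by blast
    then have "?q (x + y) - h j y \<le> ?q x" if "j \<in> I" for j
      using that by (intro cINF_greatest[OF ne]) (simp add: algebra_simps)
    then have "?q (x + y) - ?q x \<le> ?q y"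
      by (intro cINF_greatest[OF ne]) (simp add: algebra_simps)
    then show ?thesis by simp
  qed
  have le: "?q (c *\<^sub>R x) \<le> c * ?q x" if "0 < c" for c x
  proof -
    have "?q (c *\<^sub>R x) \<le> c * h i x" if "i \<in> I" for i
      using scale[OF \<open>0 < c\<close> that, of x] lower order_trans by blast
    then have "?q (c *\<^sub>R x) / c \<le> ?q x"
      using that by (intro cINF_greatest[OF ne]) (simp add: divide_le_eq mult.commute)
    then show ?thesis using that by (simp add: divide_le_eq mult.commute)
  qed
  have "?q (c *\<^sub>R x) = c * ?q x" if "0 < c" for c x
  proof (rule antisym)
    show "?q (c *\<^sub>R x) \<le> c * ?q x" using le that .
    have "?q (inverse c *\<^sub>R (c *\<^sub>R x)) \<le> inverse c * ?q (c *\<^sub>R x)"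
      using that by (intro le) simp
    then show "c * ?q x \<le> ?q (c *\<^sub>R x)"
      using that by (simp add: field_simps)
  qed
  moreover have "?q 0 = 0"
  proof (rule antisym)
    show "0 \<le> ?q 0" using ne zero(1) by (rule cINF_greatest)
    show "?q 0 \<le> 0"
    proof (rule field_le_epsilon)
      fix e :: real assume "0 < e"
      then obtain i where "i \<in> I" "h i 0 < e" using zero(2) by blast
      then show "?q 0 \<le> 0 + e" using lower[of i 0] by simp
    qed
  qed
  ultimately have "?q (c *\<^sub>R x) = c * ?q x" if "0 \<le> c" for c x
    using that by (cases "c = 0") auto
  with sub show ?thesis by (simp add: sublinear_functional_def)
qed

text \<open>Take the infimum of \<open>p (x + t *\<^sub>R a) - t * p a\<close> over
  \<open>t \<ge> 0\<close>: \<open>t = 0\<close> gives the bound by \<open>p\<close>, and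
  \<open>t = 1\<close> at \<open>- a\<close> gives \<open>p 0 - p a\<close>.\<close>

lemma sublinear_functional_tighten:
  assumes p: "sublinear_functional (p :: 'b::real_vector \<Rightarrow> real)"
  shows "\<exists>q. sublinear_functional q \<and> (\<forall>x. q x \<le> p x) \<and> q (- a) \<le> - p a"
proof -
  let ?h = "\<lambda>t x. p (x + t *\<^sub>R a) - t * p a"
  let ?q = "\<lambda>x. INF t\<in>{0..}. ?h t x"
  have lb: "- p (- x) \<le> ?h t x" if "0 \<le> t" for t x
    using sublinear_functional_add[OF p, of "x + t *\<^sub>R a" "- x"]
      sublinear_functional_scale[OF p that, of a] by simp
  have bdd: "bdd_below ((\<lambda>t. ?h t x) ` {0..})" for x
    by (rule bdd_belowI[of _ "- p (- x)"]) (use lb in auto)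
  have lower: "?q x \<le> ?h t x" if "0 \<le> t" for t x
    using bdd[of x] that by (intro cINF_lower) auto
  have "sublinear_functional ?q"
  proof (rule sublinear_functional_INF[OF _ bdd])
    fix x y and s t :: real assume "s \<in> {0..}" "t \<in> {0..}"
    moreover have "?h (s + t) (x + y) \<le> ?h s x + ?h t y"
      using sublinear_functional_add[OF p, of "x + s *\<^sub>R a" "y + t *\<^sub>R a"]
      by (simp add: algebra_simps)
    ultimately show "\<exists>k\<in>{0..}. ?h k (x + y) \<le> ?h s x + ?h t y"
      by (intro bexI[of _ "s + t"]) auto
  next
    fix c t :: real and x assume *: "0 < c" "t \<in> {0..}"
    then have "?h (c * t) (c *\<^sub>R x) \<le> c * ?h t x"
      using sublinear_functional_scale[OF p, of c "x + t *\<^sub>R a"] by (simp add: algebra_simps)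
    with * show "\<exists>k\<in>{0..}. ?h k (c *\<^sub>R x) \<le> c * ?h t x"
      by (intro bexI[of _ "c * t"]) auto
  next
    show "0 \<le> ?h t 0" if "t \<in> {0..}" for t
      using that sublinear_functional_scale[OF p] by simp
    show "\<exists>t\<in>{0..}. ?h t 0 < e" if "0 < e" for e
      using that sublinear_functional_zero[OF p] by (intro bexI[of _ 0]) auto
  qed auto
  moreover have "?q x \<le> p x" for x using lower[of 0 x] by simp
  moreover have "?q (- a) \<le> - p a"
    using lower[of 1 "- a"] sublinear_functional_zero[OF p] by simp
  ultimately show ?thesis by blast
qed

text \<open>Tightening in any direction \<open>a\<close> has to return \<open>q\<close> itself, so
  \<open>q (- a) \<le> - q a\<close>. Sublinearity gives the opposite inequality, and an odd
  sublinear functional is linear.\<close>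

lemma minimal_sublinear_functional_linear:
  assumes q: "sublinear_functional (q :: 'b::real_vector \<Rightarrow> real)"
    and min: "\<And>r. sublinear_functional r \<Longrightarrow> (\<forall>x. r x \<le> q x) \<Longrightarrow> r = q"
  shows "linear q"
proof -
  have neg: "q (- a) = - q a" for a
  proof -
    obtain r where "sublinear_functional r" "\<forall>x. r x \<le> q x" "r (- a) \<le> - q a"
      using sublinear_functional_tighten[OF q] by blast
    with min have "q (- a) \<le> - q a" by blast
    with sublinear_functional_minus[OF q, of a] show ?thesis by simp
  qed
  have "q (x + y) = q x + q y" for x y
    using sublinear_functional_add[OF q, of x y] sublinear_functional_add[OF q, of "x + y" "- y"]
    by (simp add: neg)
  moreover have "q (c *\<^sub>R x) = c * q x" for c x
    using sublinear_functional_scale[OF q, of c x] sublinear_functional_scale[OF q, of "- c" x]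
      neg[of "c *\<^sub>R x"] by (cases "0 \<le> c") auto
  ultimately show ?thesis by (intro linearI) auto
qed

lemma exists_minimal_sublinear_functional:
  assumes p: "sublinear_functional (p :: 'b::real_vector \<Rightarrow> real)"
  shows "\<exists>q. sublinear_functional q \<and> (\<forall>x. q x \<le> p x) \<and>
    (\<forall>r. sublinear_functional r \<longrightarrow> (\<forall>x. r x \<le> q x) \<longrightarrow> r = q)"
proof -
  let ?A = "{q. sublinear_functional q \<and> q \<le> p}"
  have "\<exists>q\<in>?A. \<forall>r\<in>?A. r \<le> q \<longrightarrow> r = q"
  proof (rule predicate_Zorn)
    \<comment> \<open>The order is reversed, so that a maximal element is a minimal functional. A
      nonempty chain is bounded by its pointwise infimum, which is finite because every
      \<open>q \<le> p\<close> satisfies \<open>- p (- x) \<le> q x\<close>.\<close>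
    show "partial_order_on ?A (relation_of (\<lambda>q r. r \<le> q) ?A)"
      by (intro partial_order_on_relation_ofI) auto
  next
    fix C assume C: "C \<in> Chains (relation_of (\<lambda>q r. r \<le> q) ?A)"
    then have lin: "q \<le> r \<or> r \<le> q" if "q \<in> C" "r \<in> C" for q r
      using that by (auto simp: Chains_def relation_of_def)
    show "\<exists>u\<in>?A. \<forall>a\<in>C. u \<le> a"
    proof (cases "C = {}")
      case True
      with p show ?thesis by auto
    next
      case False
      let ?u = "\<lambda>x. INF q\<in>C. q x"
      have CA: "sublinear_functional q" "q x \<le> p x" if "q \<in> C" for q x
        using that C by (auto simp: Chains_def relation_of_def le_fun_def)
      have "- p (- x) \<le> q x" if "q \<in> C" for q x
        using sublinear_functional_minus[OF CA(1)[OF that], of x] CA(2)[OF that, of "- x"] by simp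
      then have bdd: "bdd_below ((\<lambda>q. q x) ` C)" for x
        by (intro bdd_belowI2)
      have lower: "?u x \<le> q x" if "q \<in> C" for q x
        using bdd that by (rule cINF_lower)
      have "sublinear_functional ?u"
      proof (rule sublinear_functional_INF[OF False bdd])
        fix x y q r assume qr: "q \<in> C" "r \<in> C"
        then consider "q \<le> r" | "r \<le> q" using lin by blast
        then show "\<exists>k\<in>C. k (x + y) \<le> q x + r y"
        proof cases
          case 1
          then show ?thesis
            using sublinear_functional_add[OF CA(1)[OF qr(1)], of x y] qr
            by (intro bexI[of _ q]) (auto simp: le_fun_def intro: order_trans add_left_mono)
        next
          case 2
          then show ?thesis
            using sublinear_functional_add[OF CA(1)[OF qr(2)], of x y] qr
            by (intro bexI[of _ r]) (auto simp: le_fun_def intro: order_trans add_right_mono)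
        qed
      next
        show "\<exists>k\<in>C. k (c *\<^sub>R x) \<le> c * q x" if "0 < c" "q \<in> C" for c x q
          using that CA(1) sublinear_functional_scale[of q c x] by (intro bexI[of _ q]) auto
        show "0 \<le> q 0" if "q \<in> C" for q
          using CA(1) that sublinear_functional_zero by fastforce
        show "\<exists>q\<in>C. q 0 < e" if "0 < e" for e
          using that False CA(1) sublinear_functional_zero by fastforce
      qed
      moreover have "?u x \<le> p x" for x
        using False lower CA(2) by (meson ex_in_conv order_trans)
      ultimately have "?u \<in> ?A" by (simp add: le_fun_def)
      with lower show ?thesis by (intro bexI[of _ ?u]) (auto simp: le_fun_def)
    qed
  qed
  then show ?thesis by (auto simp: le_fun_def) (meson order_trans)
qed

text \<open>Tightening at \<open>a\<close> before minimizing makes the bound sharp there: everything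
  below \<open>r\<close> is at most \<open>- p a\<close> at \<open>- a\<close>, so a linear
  \<open>f\<close> below \<open>r\<close> has \<open>p a \<le> f a\<close>.\<close>

theorem Hahn_Banach_sublinear:
  assumes p: "sublinear_functional (p :: 'b::real_vector \<Rightarrow> real)"
  shows "\<exists>f. linear f \<and> (\<forall>x. f x \<le> p x) \<and> f a = p a"
proof -
  obtain r where r: "sublinear_functional r" "\<And>x. r x \<le> p x" "r (- a) \<le> - p a"
    using sublinear_functional_tighten[OF p] by blast
  obtain f where f: "sublinear_functional f" "\<And>x. f x \<le> r x"
    and min: "\<And>s. sublinear_functional s \<Longrightarrow> (\<forall>x. s x \<le> f x) \<Longrightarrow> s = f"
    using exists_minimal_sublinear_functional[OF r(1)] by blast
  have "linear f" using minimal_sublinear_functional_linear[OF f(1) min] .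
  moreover have "f x \<le> p x" for x using f(2) r(2) order_trans by blast
  moreover have "p a \<le> f a"
    using f(2)[of "- a"] r(3) linear_neg[OF \<open>linear f\<close>, of a] by simp
  ultimately show ?thesis using antisym by blast
qed

section \<open>Separating and norming functionals on \<open>(V, N)\<close>\<close>

lemma norm_onD:
  assumes "norm_on V N"
  shows "subspace V" "x \<in> V \<Longrightarrow> 0 \<le> N x" "x \<in> V \<Longrightarrow> N x = 0 \<longleftrightarrow> x = 0"
    "x \<in> V \<Longrightarrow> y \<in> V \<Longrightarrow> N (x + y) \<le> N x + N y" "x \<in> V \<Longrightarrow> N (c *\<^sub>R x) = \<bar>c\<bar> * N x"
  using assms by (auto simp: norm_on_def)

text \<open>Hahn-Banach is applied to the distance from \<open>M\<close>. A linear functional below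
  it is at most 0 at both \<open>m\<close> and \<open>- m\<close>, so it vanishes on
  \<open>M\<close>. Made sharp at \<open>z\<close>, it is at least \<delta> there, and dividing by
  that value normalizes it.\<close>

lemma dual_on_separates_subspace:
  assumes N: "norm_on V N" and M: "subspace M" "M \<subseteq> V" and z: "z \<in> V"
    and \<delta>: "0 < \<delta>" "\<And>m. m \<in> M \<Longrightarrow> \<delta> \<le> N (z - m)"
  shows "\<exists>f\<in>dual_on V N. (\<forall>m\<in>M. f m = 0) \<and> f z = 1 \<and> (\<forall>x\<in>V. \<bar>f x\<bar> \<le> N x / \<delta>)"
proof -
  note V = norm_onD(1)[OF N]
  \<comment> \<open>Sublinear functionals are defined on the whole type, but \<open>N\<close> is
    meaningful only on \<open>V\<close>; so points are first sent into \<open>V\<close> by a linear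
    projection \<open>g\<close>.\<close>
  obtain g where g: "range g \<subseteq> V" "linear g" "\<And>v. v \<in> V \<Longrightarrow> g v = v"
    using linear_exists_left_inverse_on[OF linear_id V] by auto
  have gV: "g x \<in> V" for x using g(1) by auto
  have diff: "x - m \<in> V" if "x \<in> V" "m \<in> M" for x m
    using that M V by (auto intro: subspace_diff)
  let ?p = "\<lambda>x. INF m\<in>M. N (g x - m)"
  have nonneg: "0 \<le> N (g x - m)" if "m \<in> M" for x m
    using norm_onD(2)[OF N] diff gV that by blast
  have bdd: "bdd_below ((\<lambda>m. N (g x - m)) ` M)" for x
    using nonneg by (intro bdd_belowI2)
  have lower: "?p x \<le> N (g x - m)" if "m \<in> M" for m x
    using bdd that by (rule cINF_lower)
  have M0: "0 \<in> M" using M(1) by (rule subspace_0)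
  have N0: "N 0 = 0" using norm_onD(3)[OF N, of 0] V by (simp add: subspace_0)
  have p: "sublinear_functional ?p"
  proof (rule sublinear_functional_INF[OF _ bdd])
    fix x y m k assume mk: "m \<in> M" "k \<in> M"
    have "N (g (x + y) - (m + k)) \<le> N (g x - m) + N (g y - k)"
      using norm_onD(4)[OF N diff[OF gV mk(1)] diff[OF gV mk(2)], of x y] linear_add[OF g(2)]
      by (simp add: algebra_simps)
    with mk show "\<exists>l\<in>M. N (g (x + y) - l) \<le> N (g x - m) + N (g y - k)"
      using M(1) subspace_add by blast
  next
    fix c :: real and x m assume cm: "0 < c" "m \<in> M"
    have "N (g (c *\<^sub>R x) - c *\<^sub>R m) \<le> c * N (g x - m)"
      using norm_onD(5)[OF N diff[OF gV cm(2)], of c x] linear_scale[OF g(2)] cm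
      by (simp add: algebra_simps)
    with cm show "\<exists>l\<in>M. N (g (c *\<^sub>R x) - l) \<le> c * N (g x - m)"
      using M(1) subspace_scale by blast
  next
    show "\<exists>m\<in>M. N (g 0 - m) < e" if "0 < e" for e
      using that M0 N0 linear_0[OF g(2)] by (intro bexI[of _ 0]) auto
  qed (use nonneg M0 in auto)
  obtain f where f: "linear f" "\<And>x. f x \<le> ?p x" "f z = ?p z"
    using Hahn_Banach_sublinear[OF p] by blast
  have "\<delta> \<le> ?p z"
    using M0 \<delta>(2) g(3)[OF z] by (intro cINF_greatest) auto
  with f have fz: "\<delta> \<le> f z" by simp
  have fM: "f m = 0" if "m \<in> M" for m
  proof -
    have "f k \<le> 0" if "k \<in> M" for k
      using f(2)[of k] lower[OF that, of k] g(3)[of k] that M(2) N0 by auto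
    from this[OF that] this[of "- m"] show ?thesis
      using that M(1) linear_neg[OF f(1), of m] by (simp add: subspace_neg)
  qed
  have fN: "\<bar>f x\<bar> \<le> N x" if "x \<in> V" for x
  proof -
    have "f y \<le> N y" if "y \<in> V" for y
      using f(2)[of y] lower[OF M0, of y] g(3)[OF that] by simp
    from this[OF that] this[of "- x"] show ?thesis
      using that V linear_neg[OF f(1), of x] norm_onD(5)[OF N that, of "-1"]
      by (simp add: subspace_neg)
  qed
  let ?f = "\<lambda>x. f x / f z"
  have bound: "\<bar>?f x\<bar> \<le> N x / \<delta>" if "x \<in> V" for x
    using fN[OF that] fz \<delta>(1) by (auto simp: abs_divide intro!: frac_le)
  have "?f \<in> dual_on V N"
    unfolding dual_on_def
    using bound linear_add[OF f(1)] linear_scale[OF f(1)]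
    by (auto simp: add_divide_distrib intro!: exI[of _ "1 / \<delta>"])
  with bound fM fz \<delta>(1) show ?thesis by (intro bexI[of _ ?f]) auto
qed

text \<open>For nonzero \<open>d\<close>, separate \<open>d\<close> from \<open>{0}\<close> at
  distance \<open>N d\<close> and multiply the functional by \<open>N d\<close>.\<close>

lemma dual_on_norming:
  assumes "norm_on V N" "d \<in> V"
  shows "\<exists>f\<in>dual_on V N. f d = N d \<and> (\<forall>x\<in>V. \<bar>f x\<bar> \<le> N x)"
proof (cases "d = 0")
  case True
  have "(\<lambda>x. 0) \<in> dual_on V N"
    by (auto simp: dual_on_def intro: exI[of _ 0])
  with True assms show ?thesis
    by (intro bexI[of _ "\<lambda>x. 0"]) (auto simp: norm_on_def)
next
  case False
  then have pos: "0 < N d" using assms by (auto simp: norm_on_def order_less_le)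
  obtain f where f: "f \<in> dual_on V N" "f d = 1" "\<And>x. x \<in> V \<Longrightarrow> \<bar>f x\<bar> \<le> N x / N d"
    using dual_on_separates_subspace[OF assms(1), of "{0}" d "N d"] pos assms norm_onD(1)[OF assms(1)]
    by (auto simp: subspace_0)
  have bound: "\<bar>N d * f x\<bar> \<le> N x" if "x \<in> V" for x
    using f(3)[OF that] pos by (simp add: abs_mult field_simps)
  moreover from bound have "(\<lambda>x. N d * f x) \<in> dual_on V N"
    using f(1) unfolding dual_on_def by (auto simp: algebra_simps intro!: exI[of _ 1])
  ultimately show ?thesis
    using f(2) by (intro bexI[of _ "\<lambda>x. N d * f x"]) auto
qed

section \<open>Free sequences\<close>

text \<open>A weak Delta-system lemma: \<open>H\<close> is a largest set contained in uncountably
  many of the \<open>F d\<close>, so any further \<open>b\<close> lies in only countably many of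
  these. Restricting first to sets of one size \<open>k\<close> bounds the size of
  \<open>H\<close>.\<close>

lemma Delta_root:
  fixes F :: "'a \<Rightarrow> 'c set"
  assumes E: "uncountable E" and fin: "\<And>d. d \<in> E \<Longrightarrow> finite (F d)"
  obtains E' H where "E' \<subseteq> E" "uncountable E'" "finite H"
    "\<And>b. b \<notin> H \<Longrightarrow> countable {d \<in> E'. b \<in> F d}"
proof -
  have "E = (\<Union>k. {d \<in> E. card (F d) = k})" by auto
  with E obtain k where k: "uncountable {d \<in> E. card (F d) = k}" (is "uncountable ?E")
    using countable_UN[of UNIV "\<lambda>k. {d \<in> E. card (F d) = k}"] by force
  define P where "P H \<longleftrightarrow> finite H \<and> uncountable {d \<in> ?E. H \<subseteq> F d}" for H
  have P0: "P {}" using k by (simp add: P_def)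
  have bound: "card H \<le> k" if "P H" for H
  proof -
    from that have "{d \<in> ?E. H \<subseteq> F d} \<noteq> {}"
      by (metis P_def countable_empty)
    then show ?thesis using fin by (auto intro: card_mono)
  qed
  obtain H where H: "P H" and max: "\<And>H'. P H' \<Longrightarrow> card H' \<le> card H"
    using ex_has_greatest_nat[of P "{}" card "Suc k"] P0 bound by fastforce
  let ?E' = "{d \<in> ?E. H \<subseteq> F d}"
  have "countable {d \<in> ?E'. b \<in> F d}" if "b \<notin> H" for b
  proof (rule ccontr)
    assume "uncountable {d \<in> ?E'. b \<in> F d}"
    moreover have "{d \<in> ?E'. b \<in> F d} = {d \<in> ?E. insert b H \<subseteq> F d}" by auto
    ultimately have "P (insert b H)" using H by (simp add: P_def)
    from max[OF this] show False using that H by (simp add: P_def)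
  qed
  with that[of ?E' H] H show thesis by (auto simp: P_def)
qed

lemma free_transversal:
  fixes E :: "nat \<Rightarrow> 'a set" and F :: "nat \<Rightarrow> 'a \<Rightarrow> (nat \<times> 'a) set"
  assumes E: "\<And>n. uncountable (E n)" and fin: "\<And>n d. d \<in> E n \<Longrightarrow> finite (F n d)"
  obtains t where "\<And>n. t n \<in> E n" "\<And>m n. m \<noteq> n \<Longrightarrow> (m, t m) \<notin> F n (t n)"
proof -
  have "\<exists>E' H. E' \<subseteq> E n \<and> uncountable E' \<and> finite H \<and>
      (\<forall>b. b \<notin> H \<longrightarrow> countable {d \<in> E'. b \<in> F n d})" for n
    by (rule Delta_root[OF E[of n], of "F n"]) (use fin in blast)+
  then obtain E' H where E': "\<And>n. E' n \<subseteq> E n" "\<And>n. uncountable (E' n)"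
    and H: "\<And>n. finite (H n)" "\<And>n b. b \<notin> H n \<Longrightarrow> countable {d \<in> E' n. b \<in> F n d}"
    by metis
  define B where "B = (\<Union>n. H n)"
  have B: "countable B" unfolding B_def using H(1) by (simp add: countable_finite)
  \<comment> \<open>Keeping each value outside all roots, also those of later indices, lets the
    recursion continue: for \<open>m < n\<close>, the pair \<open>(m, t m)\<close> is not in
    \<open>H n\<close>, so it lies in \<open>F n d\<close> for only countably many \<open>d\<close>
    in \<open>E' n\<close>.\<close>
  define P where "P t n d \<longleftrightarrow> d \<in> E' n \<and> (n, d) \<notin> B \<and>
      (\<forall>m<n. (n, d) \<notin> F m (t m) \<and> (m, t m) \<notin> F n d)" for t :: "nat \<Rightarrow> 'a" and n d
  have "\<exists>t. \<forall>n. P t n (t n)"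
  proof (rule dependent_wellorder_choice)
    fix d :: 'a and f g :: "nat \<Rightarrow> 'a" and n assume "\<And>y. y < n \<Longrightarrow> f y = g y"
    then show "P f n d = P g n d" by (auto simp: P_def)
  next
    fix n t assume t: "\<And>m. m < n \<Longrightarrow> P t m (t m)"
    let ?X = "snd ` (B \<union> (\<Union>m<n. F m (t m))) \<union> (\<Union>m<n. {d \<in> E' n. (m, t m) \<in> F n d})"
    have "countable {d \<in> E' n. (m, t m) \<in> F n d}" if "m < n" for m
      using t[OF that] H(2) by (auto simp: P_def B_def)
    moreover have "finite (F m (t m))" if "m < n" for m
      using t[OF that] fin E'(1) by (auto simp: P_def)
    ultimately have "countable (\<Union>m<n. {d \<in> E' n. (m, t m) \<in> F n d})" "countable (\<Union>m<n. F m (t m))"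
      by (auto intro: countable_finite)
    with B have "countable ?X" by simp
    then have "\<not> E' n \<subseteq> ?X" using E'(2)[of n] by (meson countable_subset)
    then obtain d where "d \<in> E' n" "d \<notin> ?X" by blast
    then have "P t n d" by (force simp: P_def)
    then show "\<exists>d. P t n d" ..
  qed
  then obtain t where t: "\<And>n. P t n (t n)" by blast
  show thesis
  proof
    show "t n \<in> E n" for n using t[of n] E'(1) by (auto simp: P_def)
    show "(m, t m) \<notin> F n (t n)" if "m \<noteq> n" for m n
      using that t[of m] t[of n] by (auto simp: P_def neq_iff)
  qed
qed

section \<open>Products of compact spaces with uncountable discrete subsets\<close>

definition discrete_in :: "'a topology \<Rightarrow> 'a set \<Rightarrow> bool" where
  "discrete_in X D \<longleftrightarrow> D \<subseteq> topspace X \<and> (\<forall>d\<in>D. \<exists>U. openin X U \<and> U \<inter> D = {d})"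

text \<open>For open \<open>U\<close>, the part of the closure of \<open>D\<close> inside
  \<open>U\<close> lies in the closure of \<open>U \<inter> D\<close>, a closed singleton. So
  passing to the compact closure keeps the points of \<open>D\<close> isolated.\<close>

lemma discrete_in_isolated_closure:
  assumes X: "t1_space X" and D: "discrete_in X D" and d: "d \<in> D"
  shows "\<exists>U. openin X U \<and> U \<inter> X closure_of D = {d}"
proof -
  obtain U where U: "openin X U" "U \<inter> D = {d}" "d \<in> topspace X"
    using D d unfolding discrete_in_def by blast
  have "U \<inter> X closure_of D \<subseteq> X closure_of (U \<inter> D)"
    using U(1) by (rule openin_Int_closure_of_subset)
  also have "\<dots> = {d}" using U X by (simp add: closure_of_closedin t1_space_closedin_singleton)
  finally have "U \<inter> X closure_of D = {d}"
    using U D d closure_of_subset[of D X] by (auto simp: discrete_in_def)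
  with U show ?thesis by blast
qed

lemma metacompact_spaceE:
  assumes "metacompact_space X" "\<And>U. U \<in> \<U> \<Longrightarrow> openin X U" "\<Union>\<U> = topspace X"
  obtains \<V> where "\<And>V. V \<in> \<V> \<Longrightarrow> openin X V" "\<Union>\<V> = topspace X"
    "\<And>V. V \<in> \<V> \<Longrightarrow> \<exists>U\<in>\<U>. V \<subseteq> U" "\<And>x. x \<in> topspace X \<Longrightarrow> finite {V \<in> \<V>. x \<in> V}"
proof -
  obtain \<V> where "(\<forall>V\<in>\<V>. openin X V) \<and> \<Union>\<V> = topspace X \<and> (\<forall>V\<in>\<V>. \<exists>U\<in>\<U>. V \<subseteq> U) \<and>
      (\<forall>x\<in>topspace X. finite {V \<in> \<V>. x \<in> V})"
    using assms(1)[unfolded metacompact_space_def, rule_format, of \<U>] assms(2,3) by auto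
  then show thesis by (intro that[of \<V>]) simp_all
qed

lemma not_hereditarily_metacompact_product:
  fixes K :: "nat \<Rightarrow> 'a topology"
  assumes comp: "\<And>n. compact_space (K n)" and t1: "\<And>n. t1_space (K n)"
    and D: "\<And>n. discrete_in (K n) (D n)" "\<And>n. uncountable (D n)"
  shows "\<not> hereditarily_metacompact (product_topology K UNIV)"
proof
  assume hm: "hereditarily_metacompact (product_topology K UNIV)"
  let ?X = "product_topology K UNIV"
  define L where "L n = K n closure_of D n" for n
  have DL: "D n \<subseteq> L n" and LK: "L n \<subseteq> topspace (K n)" for n
    using D(1) unfolding L_def discrete_in_def
    by (auto simp: closure_of_subset closure_of_subset_topspace)
  define Q where "Q n d = (SOME U. openin (K n) U \<and> U \<inter> L n = {d})" for n d
  have Q: "openin (K n) (Q n d)" "Q n d \<inter> L n = {d}" if "d \<in> D n" for n d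
    using someI_ex[OF discrete_in_isolated_closure[OF t1 D(1) that]]
    by (simp_all add: Q_def L_def)
  define P where "P = Pi\<^sub>E UNIV L"
  have P: "x \<in> P \<longleftrightarrow> (\<forall>n. x n \<in> L n)" for x by (auto simp: P_def)
  define slab where "slab n U = {x \<in> topspace ?X. x n \<in> U}" for n U
  have slab: "openin ?X (slab n U)" if "openin (K n) U" for n U
    using continuous_map_product_projection[of n UNIV K] that
    unfolding slab_def continuous_map_def by simp
  have slabc: "closedin ?X (slab n U)" if "closedin (K n) U" for n U
    using continuous_map_product_projection[of n UNIV K] that
    unfolding slab_def continuous_map_closedin by simp
  have PX: "P \<subseteq> topspace ?X" using LK by (auto simp: P_def)
  define S where "S = {x \<in> P. \<exists>n. x n \<in> D n}"
  have SX: "S \<subseteq> topspace ?X" using PX by (auto simp: S_def)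
  define U where "U n d = {x \<in> S. x n = d}" for n d
  define I where "I = {(n, d). d \<in> D n}"
  have "openin (subtopology ?X S) (U n d)" if "d \<in> D n" for n d
  proof -
    have "U n d = slab n (Q n d) \<inter> S"
      using Q(2)[OF that] SX by (auto simp: U_def slab_def S_def P)
    then show ?thesis using slab[OF Q(1)[OF that]] by (auto simp: openin_subtopology)
  qed
  then have op: "\<And>A. A \<in> (\<lambda>(n,d). U n d) ` I \<Longrightarrow> openin (subtopology ?X S) A"
    by (auto simp: I_def)
  have cov: "\<Union>((\<lambda>(n,d). U n d) ` I) = topspace (subtopology ?X S)"
    unfolding topspace_subtopology_subset[OF SX] by (auto simp: I_def U_def S_def)
  have "metacompact_space (subtopology ?X S)"
    using hm SX unfolding hereditarily_metacompact_def by blast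
  from metacompact_spaceE[OF this op cov] obtain \<V>
    where V: "\<And>V. V \<in> \<V> \<Longrightarrow> openin (subtopology ?X S) V" "\<Union>\<V> = S"
    "\<And>V. V \<in> \<V> \<Longrightarrow> \<exists>A\<in>(\<lambda>(n,d). U n d) ` I. V \<subseteq> A" "\<And>x. x \<in> S \<Longrightarrow> finite {V \<in> \<V>. x \<in> V}"
    unfolding topspace_subtopology_subset[OF SX] by blast
  \<comment> \<open>Each member of the refinement is assigned one slice \<open>U n d\<close> that
    contains it. If a point lies in \<open>W n d\<close> for several indices, it lies in that many
    distinct members.\<close>
  have "\<forall>V\<in>\<V>. \<exists>i. i \<in> I \<and> V \<subseteq> U (fst i) (snd i)" using V(3) by fastforce
  then obtain \<phi> where \<phi>: "\<And>V. V \<in> \<V> \<Longrightarrow> \<phi> V \<in> I"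
    "\<And>V. V \<in> \<V> \<Longrightarrow> V \<subseteq> U (fst (\<phi> V)) (snd (\<phi> V))" by metis
  define W where "W n d = \<Union>{V \<in> \<V>. \<phi> V = (n, d)}" for n d
  \<comment> \<open>\<open>F\<close> lists finitely many pairs of a coordinate and a value. A point
    of the slice of \<open>P\<close> at \<open>d\<close> that avoids them, at coordinates other than
    \<open>n\<close>, must lie in \<open>W n d\<close>.\<close>
  define good where "good n d F \<longleftrightarrow> finite F \<and>
    (\<forall>x\<in>P. x n = d \<longrightarrow> (\<forall>m. m \<noteq> n \<longrightarrow> (m, x m) \<notin> F) \<longrightarrow> x \<in> W n d)" for n d F
  have good: "\<exists>F. good n d F"
    if d: "d \<in> D n" for n d
  proof -
    have "openin (subtopology ?X S) (W n d)"
      unfolding W_def using V(1) by (intro openin_Union) auto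
    then obtain G where G: "openin ?X G" "W n d = G \<inter> S"
      by (auto simp: openin_subtopology)
    let ?T = "P \<inter> slab n {d}"
    have "closedin ?X P" unfolding P_def
      by (simp add: closedin_product_topology L_def)
    moreover have "closedin (K n) {d}"
      using t1 D(1) d by (auto simp: t1_space_closedin_singleton discrete_in_def)
    ultimately have "closedin ?X ?T" using slabc by (intro closedin_Int) auto
    moreover have "compact_space ?X" using comp by (simp add: compact_space_product_topology)
    ultimately have T: "compactin ?X ?T" by (rule closedin_compact_space[rotated])
    let ?J = "{i \<in> I. fst i \<noteq> n}"
    \<comment> \<open>A point of \<open>?T\<close> with another coordinate in some
      \<open>D m\<close> is in a slab of that coordinate. Any other point of \<open>?T\<close> lies
      in no slice except \<open>U n d\<close>, so the members containing it are indexed by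
      \<open>(n, d)\<close> and it is in \<open>G\<close>.\<close>
    let ?\<G> = "insert G ((\<lambda>i. slab (fst i) (Q (fst i) (snd i))) ` ?J)"
    have "x \<in> \<Union>?\<G>" if x: "x \<in> ?T" for x
    proof (cases "\<exists>m. m \<noteq> n \<and> x m \<in> D m")
      case True
      then obtain m where m: "m \<noteq> n" "x m \<in> D m" by blast
      then have "x \<in> slab m (Q m (x m))"
        using x PX Q(2)[OF m(2)] by (auto simp: slab_def)
      then show ?thesis using m by (auto simp: I_def intro!: exI[of _ m] exI[of _ "x m"])
    next
      case False
      have xS: "x \<in> S" "x n = d" using x d by (auto simp: S_def slab_def)
      then obtain V' where V': "V' \<in> \<V>" "x \<in> V'" using V(2) by blast
      then have "x \<in> U (fst (\<phi> V')) (snd (\<phi> V'))" "\<phi> V' \<in> I" using \<phi> by auto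
      then have "\<phi> V' = (n, d)" using False xS by (auto simp: U_def I_def prod_eq_iff)
      with V' G show ?thesis by (auto simp: W_def)
    qed
    moreover have "openin ?X A" if "A \<in> ?\<G>" for A
      using that G slab Q(1) by (auto simp: I_def)
    ultimately obtain \<F> where \<F>: "finite \<F>" "\<F> \<subseteq> ?\<G>" "?T \<subseteq> \<Union>\<F>"
      using compactinD[OF T, of ?\<G>] by blast
    then have "finite (\<F> - {G})" "\<F> - {G} \<subseteq> (\<lambda>i. slab (fst i) (Q (fst i) (snd i))) ` ?J" by auto
    then obtain F where F: "F \<subseteq> ?J" "finite F"
      "\<F> - {G} = (\<lambda>i. slab (fst i) (Q (fst i) (snd i))) ` F"
      by (meson finite_subset_image)
    \<comment> \<open>On \<open>P\<close>, being in the slab of \<open>(m, e)\<close> forces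
      \<open>x m = e\<close>, since \<open>Q m e\<close> meets \<open>L m\<close> only in
      \<open>e\<close>. A point avoiding \<open>F\<close> is therefore left to
      \<open>G\<close>.\<close>
    have "x \<in> W n d" if x: "x \<in> P" "x n = d" "\<And>m. m \<noteq> n \<Longrightarrow> (m, x m) \<notin> F" for x
    proof -
      have "x \<notin> slab (fst i) (Q (fst i) (snd i))" if "i \<in> F" for i
      proof
        assume a: "x \<in> slab (fst i) (Q (fst i) (snd i))"
        have i: "i \<in> I" "fst i \<noteq> n" using that F(1) by auto
        have "x (fst i) \<in> Q (fst i) (snd i) \<inter> L (fst i)"
          using a x(1) by (simp add: slab_def P)
        moreover have "snd i \<in> D (fst i)" using i(1) by (auto simp: I_def)
        ultimately have "x (fst i) = snd i" using Q(2) by blast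
        with x(3)[OF i(2)] that show False by simp
      qed
      moreover have "x \<in> ?T" using x PX by (auto simp: slab_def)
      ultimately have "x \<in> G" using \<F>(3) F(3) by blast
      moreover have "x \<in> S" using x d by (auto simp: S_def)
      ultimately show ?thesis using G by simp
    qed
    with F(2) show ?thesis by (auto simp: good_def)
  qed
  define F where "F n d = (SOME F. good n d F)" for n d
  have F: "good n d (F n d)" if "d \<in> D n" for n d
    unfolding F_def using good[OF that] by (rule someI_ex)
  have fin: "finite (F n d)" if "d \<in> D n" for n d
    using F[OF that] by (simp add: good_def)
  from free_transversal[of D F, OF D(2) fin] obtain t where t: "\<And>n. t n \<in> D n" "\<And>m n. m \<noteq> n \<Longrightarrow> (m, t m) \<notin> F n (t n)"
    by blast
  have tP: "t \<in> P" using t(1) DL by (auto simp: P)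
  have tW: "t \<in> W n (t n)" for n using F[OF t(1)[of n]] tP t(2) by (simp add: good_def)
  \<comment> \<open>The pairs \<open>(n, t n)\<close> are distinct, so \<open>t\<close> lies in
    infinitely many members, against point-finiteness.\<close>
  have "(n, t n) \<in> \<phi> ` {V \<in> \<V>. t \<in> V}" for n
  proof -
    obtain V where "V \<in> \<V>" "\<phi> V = (n, t n)" "t \<in> V"
      using tW[of n] by (auto simp: W_def)
    then show ?thesis by (intro image_eqI[of _ _ V]) auto
  qed
  then have "range (\<lambda>n. (n, t n)) \<subseteq> \<phi> ` {V \<in> \<V>. t \<in> V}" by blast
  moreover have "t \<in> S" using tP t(1) by (auto simp: S_def)
  ultimately have "finite (range (\<lambda>n. (n, t n)))"
    using V(4) finite_subset by blast
  moreover have "inj (\<lambda>n. (n, t n))" by (auto intro: injI)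
  ultimately show False using finite_imageD by blast
qed

section \<open>Closing off and maximal families\<close>

text \<open>Iterate \<open>h\<close> over finite subsets. The stages increase, so a finite subset
  \<open>T\<close> of their union lies in one stage, and the next stage contains
  \<open>h T\<close>.\<close>

lemma countable_finitary_closure:
  assumes "\<And>T. finite T \<Longrightarrow> countable (h T :: 'a set)"
  obtains D where "countable D" "\<And>T. finite T \<Longrightarrow> T \<subseteq> D \<Longrightarrow> h T \<subseteq> D"
proof -
  let ?G = "\<lambda>A. A \<union> \<Union>(h ` {T. T \<subseteq> A \<and> finite T})"
  define D where "D n = (?G ^^ n) {}" for n
  have Suc: "D (Suc n) = ?G (D n)" for n by (simp add: D_def)
  have "countable (D n)" for n
  proof (induction n)
    case 0
    then show ?case by (simp add: D_def)
  next
    case (Suc n)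
    then have "countable {T. T \<subseteq> D n \<and> finite T}"
      using countable_Collect_finite_subset[of "D n"] by (simp add: conj_commute)
    with Suc assms show ?case unfolding D_def[symmetric] \<open>D (Suc n) = ?G (D n)\<close>
      by (intro countable_Un countable_UN) auto
  qed
  then have "countable (\<Union>n. D n)" by simp
  moreover have "h T \<subseteq> (\<Union>n. D n)" if T: "finite T" "T \<subseteq> (\<Union>n. D n)" for T
  proof -
    have "incseq D" by (rule incseq_SucI) (auto simp: Suc)
    then have mono: "D m \<subseteq> D n" if "m \<le> n" for m n using that by (rule monoD)
    from T have "\<exists>n. T \<subseteq> D n"
    proof (induction T)
      case empty
      show ?case by simp
    next
      case (insert x T)
      then obtain m n where "T \<subseteq> D n" "x \<in> D m" by auto
      then have "insert x T \<subseteq> D (max m n)"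
        using mono[of m "max m n"] mono[of n "max m n"] by auto
      then show ?case ..
    qed
    then obtain n where "T \<subseteq> D n" ..
    with T(1) have "T \<in> {T. T \<subseteq> D n \<and> finite T}" by simp
    then have "h T \<subseteq> D (Suc n)" unfolding Suc by (intro le_supI2 Sup_upper imageI)
    then show ?thesis by (rule order_trans) (rule UN_upper, simp)
  qed
  ultimately show thesis using that by blast
qed

lemma exists_maximal_pairwise:
  "\<exists>A\<subseteq>B. pairwise R A \<and> (\<forall>b\<in>B. pairwise R (insert b A) \<longrightarrow> b \<in> A)"
proof -
  let ?S = "{A. A \<subseteq> B \<and> pairwise R A}"
  have "\<exists>A\<in>?S. \<forall>X\<in>?S. A \<subseteq> X \<longrightarrow> X = A"
  proof (rule subset_Zorn')
    fix C assume "subset.chain {A. A \<subseteq> B \<and> pairwise R A} C"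
    then have C: "\<And>A. A \<in> C \<Longrightarrow> A \<subseteq> B" "\<And>A. A \<in> C \<Longrightarrow> pairwise R A" "chain\<^sub>\<subseteq> C"
      by (auto simp: subset_chain_def chain_subset_def)
    have "R x y" if "x \<in> \<Union>C" "y \<in> \<Union>C" "x \<noteq> y" for x y
    proof -
      from that obtain X Y where XY: "x \<in> X" "X \<in> C" "y \<in> Y" "Y \<in> C" by blast
      with C(3) have "X \<subseteq> Y \<or> Y \<subseteq> X" by (auto simp: chain_subset_def)
      with XY obtain Z where "Z \<in> C" "x \<in> Z" "y \<in> Z" by blast
      with C(2) that(3) show ?thesis by (auto dest: pairwiseD)
    qed
    then have "pairwise R (\<Union>C)" by (simp add: pairwise_def)
    with C(1) show "\<Union>C \<in> {A. A \<subseteq> B \<and> pairwise R A}" by blast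
  qed
  then obtain A where S: "A \<in> ?S" "\<forall>X\<in>?S. A \<subseteq> X \<longrightarrow> X = A" by (rule bexE)
  then have A: "A \<subseteq> B" "pairwise R A" by simp_all
  have max: "X = A" if "X \<subseteq> B" "pairwise R X" "A \<subseteq> X" for X
    using S(2) that by simp
  have "b \<in> A" if "b \<in> B" "pairwise R (insert b A)" for b
  proof -
    have "insert b A = A" by (rule max) (use A(1) that in auto)
    then show ?thesis by blast
  qed
  with A show ?thesis by blast
qed

section \<open>Weakly compact sets with countable spread\<close>

lemma openin_weak_topology_on:
  assumes "f \<in> dual_on V N" "open U"
  shows "openin (weak_topology_on V N) {x \<in> V. f x \<in> U}"
  unfolding weak_topology_on_def using assms
  by (intro topology_generated_by_Basis CollectI exI[of _ f] exI[of _ U]) simp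

lemma continuous_map_dual_on:
  assumes "f \<in> dual_on V N"
  shows "continuous_map (weak_topology_on V N) euclideanreal f"
  using openin_weak_topology_on[OF assms] by (simp add: continuous_map_def)

lemma closedin_weak_topology_on:
  assumes "f \<in> dual_on V N" "closed U"
  shows "closedin (weak_topology_on V N) {x \<in> V. f x \<in> U}"
  using continuous_map_dual_on[OF assms(1)] assms(2) by (simp add: continuous_map_closedin)

lemma dual_on_diff:
  assumes "subspace V" "f \<in> dual_on V N" "x \<in> V" "y \<in> V"
  shows "f (x - y) = f x - f y"
proof -
  have "x - y \<in> V" using assms by (simp add: subspace_diff)
  with assms have "f ((x - y) + y) = f (x - y) + f y"
    unfolding dual_on_def by blast
  then show ?thesis by simp
qed

lemma norm_on_triangle:
  assumes "norm_on V N" "x \<in> V" "y \<in> V" "z \<in> V"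
  shows "N (x - z) \<le> N (x - y) + N (y - z)"
proof -
  note V = norm_onD(1)[OF assms(1)]
  have "N (x - y + (y - z)) \<le> N (x - y) + N (y - z)"
    using norm_onD(4)[OF assms(1)] subspace_diff[OF V] assms(2-4) by blast
  then show ?thesis by simp
qed

section \<open>Norm closures of countable sets, and metrizability\<close>

definition norm_closure :: "'b::real_vector set \<Rightarrow> ('b \<Rightarrow> real) \<Rightarrow> 'b set \<Rightarrow> 'b set" where
  "norm_closure V N D = {x \<in> V. \<forall>e>0. \<exists>d\<in>D. N (x - d) < e}"

lemma norm_closure_superset:
  assumes "norm_on V N" "D \<subseteq> V"
  shows "D \<subseteq> norm_closure V N D"
proof -
  have "N 0 = 0" using norm_onD[OF assms(1)] by (simp add: subspace_0)
  then show ?thesis using assms(2) by (force simp: norm_closure_def)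
qed

text \<open>Only rational scalars are demanded, so that \<open>D\<close> can be countable;
  approximation supplies the real ones.\<close>

lemma subspace_norm_closure:
  assumes N: "norm_on V N" and D: "D \<subseteq> V" "0 \<in> D"
    and add: "\<And>x y. x \<in> D \<Longrightarrow> y \<in> D \<Longrightarrow> x + y \<in> D"
    and scale: "\<And>q x. q \<in> \<rat> \<Longrightarrow> x \<in> D \<Longrightarrow> q *\<^sub>R x \<in> D"
  shows "subspace (norm_closure V N D)"
proof (rule subspaceI)
  note V = norm_onD(1)[OF N]
  show "0 \<in> norm_closure V N D"
    using norm_closure_superset[OF N D(1)] D(2) by blast
  show "x + y \<in> norm_closure V N D"
    if x: "x \<in> norm_closure V N D" and y: "y \<in> norm_closure V N D" for x y
  proof -
    have "\<exists>d\<in>D. N (x + y - d) < e" if "0 < e" for e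
    proof -
      obtain c d where cd: "c \<in> D" "d \<in> D" "N (x - c) < e / 2" "N (y - d) < e / 2"
        using x y \<open>0 < e\<close> half_gt_zero[of e] unfolding norm_closure_def by blast
      have "N (x + y - (c + d)) \<le> N (x - c) + N (y - d)"
        using norm_onD(4)[OF N, of "x - c" "y - d"] x y cd D(1) V
        by (auto simp: norm_closure_def subspace_diff subset_iff algebra_simps)
      with cd add show ?thesis by (intro bexI[of _ "c + d"]) auto
    qed
    with x y V show ?thesis by (auto simp: norm_closure_def subspace_add)
  qed
  show "c *\<^sub>R x \<in> norm_closure V N D" if x: "x \<in> norm_closure V N D" for c x
  proof -
    have "\<exists>d\<in>D. N (c *\<^sub>R x - d) < e" if e: "0 < e" for e
    proof -
      \<comment> \<open>The difference is split as
        \<open>c *\<^sub>R (x - d) + (c - q) *\<^sub>R d\<close>. The constants \<delta> and \<eta>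
        keep each summand within \<open>e / 2\<close>; adding 1 avoids a zero denominator.\<close>
      define \<delta> where "\<delta> = e / (2 * (\<bar>c\<bar> + 1))"
      have "0 < \<delta>" using e by (simp add: \<delta>_def)
      then obtain d where d: "d \<in> D" "N (x - d) < \<delta>"
        using x unfolding norm_closure_def by blast
      have dV: "d \<in> V" "x \<in> V" "x - d \<in> V"
        using d D(1) x V by (auto simp: norm_closure_def subspace_diff)
      have Nd: "0 \<le> N d" using norm_onD(2)[OF N dV(1)] .
      define \<eta> where "\<eta> = e / (2 * (N d + 1))"
      have "0 < \<eta>" using e Nd by (simp add: \<eta>_def)
      then obtain q where q: "q \<in> \<rat>" "c < q" "q < c + \<eta>"
        using Rats_dense_in_real[of c "c + \<eta>"] by auto
      have "N (c *\<^sub>R x - q *\<^sub>R d) = N (c *\<^sub>R (x - d) + (c - q) *\<^sub>R d)"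
        by (simp add: algebra_simps)
      also have "\<dots> \<le> \<bar>c\<bar> * N (x - d) + \<bar>c - q\<bar> * N d"
        using norm_onD(4,5)[OF N] dV V by (metis subspace_scale)
      also have "\<dots> < e"
      proof -
        have "\<bar>c\<bar> * N (x - d) \<le> \<bar>c\<bar> * \<delta>"
          using d by (intro mult_left_mono) auto
        also have "\<dots> < (\<bar>c\<bar> + 1) * \<delta>" using \<open>0 < \<delta>\<close> by simp
        also have "\<dots> = e / 2" by (simp add: \<delta>_def divide_simps)
        finally have 1: "\<bar>c\<bar> * N (x - d) < e / 2" .
        have "\<bar>c - q\<bar> * N d \<le> \<eta> * N d"
          using q Nd by (intro mult_right_mono) auto
        also have "\<dots> \<le> \<eta> * (N d + 1)" using \<open>0 < \<eta>\<close> by simp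
        also have "\<dots> = e / 2" using Nd by (simp add: \<eta>_def divide_simps)
        finally show ?thesis using 1 by simp
      qed
      finally show ?thesis using scale[OF q(1) d(1)] by blast
    qed
    with x V show ?thesis by (auto simp: norm_closure_def subspace_scale)
  qed
qed

text \<open>The bound is taken to be a natural number because it will index countably many families
  of functionals.\<close>

lemma dual_on_separates_norm_closure:
  assumes N: "norm_on V N" and D: "D \<subseteq> V" and M: "subspace (norm_closure V N D)"
    and z: "z \<in> V" "z \<notin> norm_closure V N D"
  shows "\<exists>f\<in>dual_on V N. (\<forall>m\<in>norm_closure V N D. f m = 0) \<and> f z = 1 \<and>
    (\<exists>k::nat. \<forall>x\<in>V. \<bar>f x\<bar> \<le> k * N x)"
proof -
  obtain \<delta> where \<delta>: "0 < \<delta>" "\<And>d. d \<in> D \<Longrightarrow> \<delta> \<le> N (z - d)"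
    using z by (fastforce simp: norm_closure_def not_less)
  have "\<delta> \<le> N (z - m)" if m: "m \<in> norm_closure V N D" for m
  proof (rule field_le_epsilon)
    fix e :: real assume "0 < e"
    then obtain d where d: "d \<in> D" "N (m - d) < e" using m by (auto simp: norm_closure_def)
    have "N (z - d) \<le> N (z - m) + N (m - d)"
      using d D m z by (intro norm_on_triangle[OF N]) (auto simp: norm_closure_def)
    with d \<delta>(2)[of d] show "\<delta> \<le> N (z - m) + e" by simp
  qed
  moreover have "norm_closure V N D \<subseteq> V" by (auto simp: norm_closure_def)
  ultimately obtain f where f: "f \<in> dual_on V N" "\<forall>m\<in>norm_closure V N D. f m = 0" "f z = 1"
    "\<forall>x\<in>V. \<bar>f x\<bar> \<le> N x / \<delta>"
    using dual_on_separates_subspace[OF N M _ z(1) \<delta>(1)] by blast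
  obtain k :: nat where k: "1 / \<delta> \<le> k" using real_arch_simple by blast
  have "\<bar>f x\<bar> \<le> k * N x" if "x \<in> V" for x
    using f(4) that mult_right_mono[OF k norm_onD(2)[OF N that]] by force
  with f show ?thesis by blast
qed

text \<open>Mazur's theorem for subspaces: the functional that separates an outside point is nonzero
  on a weak neighbourhood of it, which misses the closure.\<close>

lemma closedin_weak_norm_closure:
  assumes "norm_on V N" "D \<subseteq> V" "subspace (norm_closure V N D)"
  shows "closedin (weak_topology_on V N) (norm_closure V N D)"
proof -
  let ?M = "norm_closure V N D"
  have "\<exists>T. openin (weak_topology_on V N) T \<and> z \<in> T \<and> T \<subseteq> V - ?M" if "z \<in> V - ?M" for z
  proof -
    have "z \<in> V" "z \<notin> ?M" using that by auto
    then obtain f where "f \<in> dual_on V N" "\<forall>m\<in>?M. f m = 0" "f z = 1"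
      using dual_on_separates_norm_closure[OF assms] by blast
    then show ?thesis
      using openin_weak_topology_on[of f V N "- {0}"] that
      by (intro exI[of _ "{x \<in> V. f x \<in> - {0}}"]) auto
  qed
  then have "openin (weak_topology_on V N) (V - ?M)"
    by (subst openin_subopen) blast
  then show ?thesis by (auto simp: closedin_def norm_closure_def)
qed

text \<open>The norming functionals of the points of \<open>D\<close> map \<open>C\<close>
  continuously and injectively into a countable power of the real line; by compactness this is an
  embedding.\<close>

lemma metrizable_weakly_compact_separable:
  assumes N: "norm_on V N" and C: "compactin (weak_topology_on V N) C"
    and D: "countable D" "D \<subseteq> V" "subspace (norm_closure V N D)" "C \<subseteq> norm_closure V N D"
  shows "metrizable_space (subtopology (weak_topology_on V N) C)"
proof -
  note V = norm_onD(1)[OF N]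
  let ?W = "subtopology (weak_topology_on V N) C"
  let ?Y = "product_topology (\<lambda>_. euclideanreal) D"
  have CV: "C \<subseteq> V" using C by (auto simp: compactin_def)
  obtain g where g: "\<And>d. d \<in> D \<Longrightarrow> g d \<in> dual_on V N" "\<And>d. d \<in> D \<Longrightarrow> g d d = N d"
    "\<And>d x. d \<in> D \<Longrightarrow> x \<in> V \<Longrightarrow> \<bar>g d x\<bar> \<le> N x"
    using dual_on_norming[OF N] D(2) that by (metis subsetD)
  let ?h = "\<lambda>x. \<lambda>d\<in>D. g d x"
  have "continuous_map ?W ?Y ?h"
    using continuous_map_from_subtopology[OF continuous_map_dual_on[OF g(1)]]
    by (auto simp: continuous_map_componentwise)
  moreover have "inj_on ?h (topspace ?W)"
  proof (rule inj_onI, rule ccontr)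
    fix x y assume xy: "x \<in> topspace ?W" "y \<in> topspace ?W" "?h x = ?h y" "x \<noteq> y"
    then have xyC: "x \<in> C" "y \<in> C" by auto
    then have V2: "x \<in> V" "y \<in> V" "x - y \<in> V" using CV V by (blast intro: subspace_diff)+
    have "x - y \<in> norm_closure V N D" using D(3,4) xyC by (auto intro: subspace_diff)
    moreover have "0 < N (x - y)"
      using norm_onD(2,3)[OF N V2(3)] xy(4) by simp
    \<comment> \<open>If \<open>g d\<close> agrees at \<open>x\<close> and \<open>y\<close>, it is
      \<open>- N d\<close> at \<open>x - y - d\<close>. Hence \<open>N d \<le> N (x - y - d)\<close>
      and \<open>N (x - y) \<le> 2 * N (x - y - d)\<close>, which the factor one half
      excludes.\<close>
    ultimately obtain d where d: "d \<in> D" "N (x - y - d) < N (x - y) / 2"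
      unfolding norm_closure_def using half_gt_zero by blast
    have dV: "d \<in> V" "x - y - d \<in> V" using d D(2) V V2 by (auto simp: subspace_diff)
    have "g d x = g d y" using fun_cong[OF xy(3), of d] d by simp
    then have "g d (x - y) = 0" using dual_on_diff[OF V g(1)[OF d(1)] V2(1,2)] by simp
    then have "g d (x - y - d) = - N d"
      using dual_on_diff[OF V g(1)[OF d(1)] V2(3) dV(1)] g(2)[OF d(1)] by simp
    then have "N d \<le> N (x - y - d)" using g(3)[OF d(1) dV(2)] by simp
    moreover have "N (x - y) \<le> N (x - y - d) + N d"
      using norm_onD(4)[OF N dV(2,1)] by simp
    ultimately show False using d(2) by simp
  qed
  moreover have "compact_space ?W" using C by (simp add: compact_space_subtopology)
  moreover have "Hausdorff_space ?Y" by (simp add: Hausdorff_space_product_topology)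
  ultimately have "embedding_map ?W ?Y ?h"
    by (intro continuous_imp_embedding_map) auto
  then have "?W homeomorphic_space subtopology ?Y (?h ` topspace ?W)"
    by (rule embedding_map_imp_homeomorphic_space)
  moreover have "metrizable_space ?Y"
    using D(1) by (simp add: metrizable_space_product_topology metrizable_space_euclidean)
  ultimately show ?thesis
    using homeomorphic_metrizable_space metrizable_space_subtopology by blast
qed

text \<open>By \<open>hit\<close>, the closed rational boxes around the values at \<open>x\<close>
  have the finite intersection property in the compact set \<open>C \<inter> M\<close>. A common
  point has the values of \<open>x\<close>, by density of the rationals.\<close>

lemma weakly_compact_retract_point:
  assumes N: "norm_on V N" and C: "compactin (weak_topology_on V N) C"
    and M: "closedin (weak_topology_on V N) M" and \<Phi>: "\<Phi> \<subseteq> dual_on V N"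
    and hit: "\<And>T. finite T \<Longrightarrow> T \<subseteq> \<Phi> \<times> \<rat> \<times> \<rat> \<Longrightarrow> (\<exists>x\<in>C. \<forall>(f, a, b)\<in>T. a < f x \<and> f x < b) \<Longrightarrow>
      \<exists>y\<in>C \<inter> M. \<forall>(f, a, b)\<in>T. a < f y \<and> f y < b"
    and x: "x \<in> C"
  obtains y where "y \<in> C \<inter> M" "\<And>f. f \<in> \<Phi> \<Longrightarrow> f y = f x"
proof -
  let ?W = "weak_topology_on V N"
  have CM: "compactin ?W (C \<inter> M)"
    using closed_Int_compactin[OF M C] by (simp add: Int_commute)
  define J where "J = {(f, a, b). f \<in> \<Phi> \<and> a \<in> \<rat> \<and> b \<in> \<rat> \<and> a < f x \<and> f x < b}"
  define Z where "Z = (\<lambda>(f :: 'a \<Rightarrow> real, a, b). {z \<in> V. f z \<in> {a..b}})"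
  have "C \<inter> M \<inter> \<Inter>(Z ` J) \<noteq> {}"
  proof (rule compactin_fip[THEN iffD1, OF CM, THEN conjunct2, rule_format], intro conjI ballI allI impI)
    show "closedin ?W c" if "c \<in> Z ` J" for c
      using that \<Phi> by (auto simp: J_def Z_def simp del: atLeastAtMost_iff intro!: closedin_weak_topology_on)
  next
    fix \<F> assume "finite \<F> \<and> \<F> \<subseteq> Z ` J"
    then obtain T where T: "T \<subseteq> J" "finite T" "\<F> = Z ` T"
      by (meson finite_subset_image)
    have "\<exists>x\<in>C. \<forall>(f, a, b)\<in>T. a < f x \<and> f x < b"
      using T(1) x by (auto simp: J_def)
    then obtain y where y: "y \<in> C \<inter> M" "\<forall>(f, a, b)\<in>T. a < f y \<and> f y < b"
      using hit[OF T(2)] T(1) by (force simp: J_def)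
    moreover have "y \<in> V" using y C by (auto simp: compactin_def)
    ultimately have "y \<in> C \<inter> M \<inter> \<Inter>\<F>"
      unfolding T(3) Z_def by force
    then show "C \<inter> M \<inter> \<Inter>\<F> \<noteq> {}" by blast
  qed
  then obtain y where y: "y \<in> C \<inter> M" "\<And>i. i \<in> J \<Longrightarrow> y \<in> Z i" by blast
  have "f y = f x" if f: "f \<in> \<Phi>" for f
  proof -
    have between: "a \<le> f y \<and> f y \<le> b" if "a \<in> \<rat>" "b \<in> \<rat>" "a < f x" "f x < b" for a b
      using y(2)[of "(f, a, b)"] that f by (auto simp: J_def Z_def)
    obtain a b where ab: "a \<in> \<rat>" "a < f x" "b \<in> \<rat>" "f x < b"
      using Rats_dense_in_real[of "f x - 1" "f x"] Rats_dense_in_real[of "f x" "f x + 1"] by auto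
    show ?thesis
    proof (rule ccontr)
      assume "f y \<noteq> f x"
      then consider "f y < f x" | "f x < f y" by linarith
      then show False
      proof cases
        case 1
        then obtain q where "q \<in> \<rat>" "f y < q" "q < f x" using Rats_dense_in_real by blast
        with between[of q b] ab show False by simp
      next
        case 2
        then obtain q where "q \<in> \<rat>" "f x < q" "q < f y" using Rats_dense_in_real by blast
        with between[of a q] ab show False by simp
      qed
    qed
  qed
  with y(1) that show thesis by blast
qed

theorem weakly_compact_countable_spread_metrizable:
  assumes N: "norm_on V N" and C: "compactin (weak_topology_on V N) C"
    and spread: "\<And>D. D \<subseteq> C \<Longrightarrow> discrete_in (weak_topology_on V N) D \<Longrightarrow> countable D"
  shows "metrizable_space (subtopology (weak_topology_on V N) C)"
proof -
  let ?W = "weak_topology_on V N"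
  note V = norm_onD(1)[OF N]
  have CV: "C \<subseteq> V" using C by (auto simp: compactin_def)
  define B where "B v k = {(x, f). x \<in> C \<and> f \<in> dual_on V N \<and> (\<forall>z\<in>V. \<bar>f z\<bar> \<le> real k * N z) \<and>
    f v = 0 \<and> f x = 1}" for v k
  \<comment> \<open>This relation is not symmetric; \<open>pairwise\<close> imposes it in both
    orders.\<close>
  define R where "R = (\<lambda>(x :: 'a, f :: 'a \<Rightarrow> real) (y :: 'a, g :: 'a \<Rightarrow> real). \<bar>f y\<bar> \<le> 1 / 2)"
  have "\<exists>A\<subseteq>B v k. pairwise R A \<and> (\<forall>b\<in>B v k. pairwise R (insert b A) \<longrightarrow> b \<in> A)" for v k
    by (rule exists_maximal_pairwise)
  then obtain A where AB: "\<And>v k. A v k \<subseteq> B v k" and AR: "\<And>v k. pairwise R (A v k)"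
    and Amax: "\<And>v k b. b \<in> B v k \<Longrightarrow> pairwise R (insert b (A v k)) \<Longrightarrow> b \<in> A v k"
    by metis
  have A: "x \<in> C" "f \<in> dual_on V N" "\<forall>z\<in>V. \<bar>f z\<bar> \<le> real k * N z" "f v = 0" "f x = 1"
    if "(x, f) \<in> A v k" for x f v k
    using AB[of v k] that by (auto simp: B_def)
  have small: "\<bar>f y\<bar> \<le> 1 / 2" if "(x, f) \<in> A v k" "(y, g) \<in> A v k" "(x, f) \<noteq> (y, g)" for x f y g v k
    using pairwiseD[OF AR that] by (simp add: R_def)
  \<comment> \<open>Distinct pairs have distinct points, since \<open>f x = 1\<close> exceeds 1/2,
    and the set where \<open>f\<close> exceeds 1/2 isolates \<open>x\<close> among them.\<close>
  have cA: "countable (A v k)" for v k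
  proof -
    have "inj_on fst (A v k)"
      using small A(5) by (fastforce intro!: inj_onI)
    moreover have "discrete_in ?W (fst ` A v k)"
      unfolding discrete_in_def
    proof (intro conjI ballI)
      show "fst ` A v k \<subseteq> topspace ?W" using A(1) CV by auto
      fix x assume "x \<in> fst ` A v k"
      then obtain f where xf: "(x, f) \<in> A v k" by auto
      have "z = x" if "(z, g) \<in> A v k" "1 / 2 < f z" for z g
        using small[OF xf that(1)] that(2) by (cases "(x, f) = (z, g)") auto
      then have "{z \<in> V. f z \<in> {1/2<..}} \<inter> fst ` A v k \<subseteq> {x}" by auto
      moreover have "x \<in> {z \<in> V. f z \<in> {1/2<..}} \<inter> fst ` A v k"
        using A(1,5)[OF xf] CV imageI[OF xf, of fst] by auto
      ultimately have "{z \<in> V. f z \<in> {1/2<..}} \<inter> fst ` A v k = {x}" by blast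
      then show "\<exists>U. openin ?W U \<and> U \<inter> fst ` A v k = {x}"
        using openin_weak_topology_on[OF A(2)[OF xf] open_greaterThan, of "1/2"]
        by (intro exI[of _ "{z \<in> V. f z \<in> {1/2<..}}"] conjI)
    qed
    moreover have "fst ` A v k \<subseteq> C" using A(1) by auto
    ultimately show ?thesis using spread countable_image_inj_eq by blast
  qed
  define \<Psi> where "\<Psi> T = (\<Union>v\<in>T. \<Union>k. snd ` A v k)" for T
  \<comment> \<open>A chosen witness in \<open>C\<close> for the box \<open>T\<close>. If
    \<open>C\<close> misses the box, the choice is arbitrary, and intersecting with \<open>V\<close>
    in \<open>h\<close> discards it when it falls outside \<open>V\<close>.\<close>
  define w where "w T = (SOME y. y \<in> C \<and> (\<forall>(f, a, b)\<in>T. a < f y \<and> f y < b))"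
    for T :: "(('a \<Rightarrow> real) \<times> real \<times> real) set"
  \<comment> \<open>Zero, sums and rational multiples make the norm closure a subspace; the points
    of the families keep those indexed by \<open>D\<close> inside \<open>D\<close>; the witnesses
    \<open>w\<close> yield \<open>hit\<close>.\<close>
  define h where "h T = V \<inter> (insert 0 ((\<lambda>(x, y). x + y) ` (T \<times> T)) \<union> (\<lambda>(q, x). q *\<^sub>R x) ` (\<rat> \<times> T)
    \<union> (\<Union>v\<in>T. \<Union>k. fst ` A v k) \<union> w ` {T'. finite T' \<and> T' \<subseteq> \<Psi> T \<times> \<rat> \<times> \<rat>})" for T
  have "countable (h T)" if "finite T" for T
  proof -
    have T: "countable T" using that by (rule countable_finite)
    then have "countable (\<Psi> T)" unfolding \<Psi>_def using cA by (intro countable_UN countable_image) auto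
    then have "countable {T'. finite T' \<and> T' \<subseteq> \<Psi> T \<times> \<rat> \<times> \<rat>}"
      by (intro countable_Collect_finite_subset countable_SIGMA countable_rat)
    then show ?thesis unfolding h_def using T cA
      by (intro countable_Int2 countable_Un countable_insert countable_UN countable_image
          countable_SIGMA countable_rat) auto
  qed
  then obtain D0 where D0: "countable D0" "\<And>T. finite T \<Longrightarrow> T \<subseteq> D0 \<Longrightarrow> h T \<subseteq> D0"
    using countable_finitary_closure by metis
  define D where "D = D0 \<inter> V"
  have hD: "h T \<subseteq> D" if "finite T" "T \<subseteq> D" for T
    using D0(2)[of T] that by (auto simp: D_def h_def)
  have D: "countable D" "D \<subseteq> V" using D0(1) by (auto simp: D_def)
  have D_0: "0 \<in> D" using hD[of "{}"] V by (auto simp: h_def subspace_0)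
  have D_add: "x + y \<in> D" if "x \<in> D" "y \<in> D" for x y
    using hD[of "{x, y}"] that D(2) V by (auto simp: h_def subspace_add subset_iff)
  have D_scale: "q *\<^sub>R x \<in> D" if "q \<in> \<rat>" "x \<in> D" for q x
  proof -
    have "q *\<^sub>R x \<in> h {x}" using that D(2) V by (force simp: h_def subspace_scale)
    then show ?thesis using hD[of "{x}"] that by auto
  qed
  have D_A: "x \<in> D" if "(x, f) \<in> A v k" "v \<in> D" for x f v k
  proof -
    have "x \<in> fst ` A v k" using imageI[OF that(1), of fst] by simp
    moreover have "x \<in> V" using A(1)[OF that(1)] CV by blast
    ultimately have "x \<in> h {v}" by (auto simp: h_def)
    then show ?thesis using hD[of "{v}"] that by auto
  qed
  define M where "M = norm_closure V N D"
  have M: "subspace M" unfolding M_def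
    using N D(2) D_0 D_add D_scale by (rule subspace_norm_closure)
  have DM: "D \<subseteq> M" unfolding M_def using N D(2) by (rule norm_closure_superset)
  have Mc: "closedin ?W M" unfolding M_def
    using closedin_weak_norm_closure[OF N D(2)] M by (simp add: M_def)
  have \<Psi>V: "\<Psi> D \<subseteq> dual_on V N" using A(2) by (auto simp: \<Psi>_def)
  have hit: "\<exists>y\<in>C \<inter> M. \<forall>(f, a, b)\<in>T. a < f y \<and> f y < b"
    if T: "finite T" "T \<subseteq> \<Psi> D \<times> \<rat> \<times> \<rat>" and ex: "\<exists>x\<in>C. \<forall>(f, a, b)\<in>T. a < f x \<and> f x < b" for T
  proof -
    \<comment> \<open>Each of the finitely many conditions uses a functional from a family indexed
      by one point of \<open>D\<close>, so a finite subset of \<open>D\<close> already generates the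
      box and its witness.\<close>
    have "\<exists>v. v \<in> D \<and> fst i \<in> (\<Union>k. snd ` A v k)" if "i \<in> T" for i
    proof -
      have "fst i \<in> \<Psi> D" using T(2) that by auto
      then show ?thesis unfolding \<Psi>_def by blast
    qed
    then obtain s where s: "\<And>i. i \<in> T \<Longrightarrow> s i \<in> D" "\<And>i. i \<in> T \<Longrightarrow> fst i \<in> (\<Union>k. snd ` A (s i) k)"
      by metis
    have w: "w T \<in> C \<and> (\<forall>(f, a, b)\<in>T. a < f (w T) \<and> f (w T) < b)"
      unfolding w_def by (rule someI_ex) (use ex in \<open>unfold Bex_def\<close>)
    have "i \<in> \<Psi> (s ` T) \<times> \<rat> \<times> \<rat>" if "i \<in> T" for i
    proof -
      have "fst i \<in> \<Psi> (s ` T)" using s(2)[OF that] that by (auto simp: \<Psi>_def)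
      moreover have "snd i \<in> \<rat> \<times> \<rat>" using T(2) that by auto
      ultimately show ?thesis by (simp add: mem_Times_iff)
    qed
    then have "T \<subseteq> \<Psi> (s ` T) \<times> \<rat> \<times> \<rat>" by blast
    then have "w T \<in> h (s ` T)" using T(1) w CV unfolding h_def by blast
    then have "w T \<in> D" using hD[of "s ` T"] T(1) s(1) by blast
    with w DM show ?thesis by blast
  qed
  have "C \<subseteq> M"
  proof (rule ccontr)
    assume "\<not> C \<subseteq> M"
    then obtain x where x: "x \<in> C" "x \<notin> M" by blast
    obtain f and k :: nat where f: "f \<in> dual_on V N" "\<And>m. m \<in> M \<Longrightarrow> f m = 0" "f x = 1"
      "\<And>z. z \<in> V \<Longrightarrow> \<bar>f z\<bar> \<le> k * N z"
      using dual_on_separates_norm_closure[OF N D(2), of x] M x CV unfolding M_def by blast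
    obtain y where y: "y \<in> C \<inter> M" "\<And>g. g \<in> \<Psi> D \<Longrightarrow> g y = g x"
      using weakly_compact_retract_point[OF N C Mc \<Psi>V hit x(1)] by blast
    have yV: "y \<in> V" using y CV by auto
    \<comment> \<open>With this radius, \<open>g v = 0\<close> and \<open>g x = g y\<close> give
      \<bar>\<open>g x\<close>\<bar> \<le> \<open>k * N (y - v)\<close> \<le> 1/2; the added 1
      covers \<open>k = 0\<close>.\<close>
    have "0 < 1 / (2 * (real k + 1))" by simp
    then obtain v where v: "v \<in> D" "N (y - v) < 1 / (2 * (real k + 1))"
      using y(1) unfolding M_def norm_closure_def by blast
    have vV: "v \<in> V" "y - v \<in> V" using v D(2) yV V by (auto simp: subspace_diff)
    have "(x, f) \<in> B v k"
      using f x v DM by (auto simp: B_def)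
    moreover have "R (x, f) (z, g) \<and> R (z, g) (x, f)" if zg: "(z, g) \<in> A v k" for z g
    proof
      have "f z = 0" using f(2) D_A[OF zg v(1)] DM by blast
      then show "R (x, f) (z, g)" by (simp add: R_def)
      have "g \<in> \<Psi> D" using zg v(1) by (force simp: \<Psi>_def)
      then have "g x = g y" by (simp add: y(2))
      also have "\<dots> = g (y - v)"
        using dual_on_diff[OF V A(2)[OF zg] yV vV(1)] A(4)[OF zg] by simp
      finally have "\<bar>g x\<bar> \<le> k * N (y - v)" using A(3)[OF zg] vV(2) by simp
      also have "\<dots> \<le> k * (1 / (2 * (real k + 1)))"
        using v(2) by (intro mult_left_mono) auto
      also have "\<dots> \<le> 1 / 2" by (simp add: field_simps)
      finally show "R (z, g) (x, f)" by (simp add: R_def)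
    qed
    then have "pairwise R (insert (x, f) (A v k))"
      using AR by (auto simp: pairwise_insert)
    \<comment> \<open>Maximality makes \<open>x\<close> a point of a family indexed by
      \<open>v\<close> in \<open>D\<close>, and all such points belong to \<open>D\<close>.\<close>
    ultimately have "(x, f) \<in> A v k" by (rule Amax)
    then have "x \<in> M" using D_A v(1) DM by blast
    with x(2) show False ..
  qed
  with metrizable_weakly_compact_separable[OF N C D] M show ?thesis by (simp add: M_def)
qed

section \<open>Transfer of discrete sets along homeomorphisms, and the conclusion\<close>

lemma discrete_in_subtopology:
  assumes "discrete_in X D" "D \<subseteq> S"
  shows "discrete_in (subtopology X S) D"
  unfolding discrete_in_def
proof (intro conjI ballI)
  show "D \<subseteq> topspace (subtopology X S)" using assms by (auto simp: discrete_in_def)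
  fix d assume "d \<in> D"
  then obtain U where "openin X U" "U \<inter> D = {d}" using assms by (auto simp: discrete_in_def)
  with assms(2) show "\<exists>U. openin (subtopology X S) U \<and> U \<inter> D = {d}"
    by (intro exI[of _ "U \<inter> S"]) (auto simp: openin_subtopology)
qed

lemma discrete_in_homeomorphic_image:
  assumes h: "homeomorphic_map X Y h" and D: "discrete_in X D"
  shows "discrete_in Y (h ` D)"
  unfolding discrete_in_def
proof (intro conjI ballI)
  have DX: "D \<subseteq> topspace X" and inj: "inj_on h (topspace X)" and surj: "h ` topspace X = topspace Y"
    using h D by (auto simp: discrete_in_def homeomorphic_map_def quotient_map_def)
  show "h ` D \<subseteq> topspace Y" using DX surj by blast
  fix y assume "y \<in> h ` D"
  then obtain d where d: "d \<in> D" "y = h d" by blast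
  then obtain U where U: "openin X U" "U \<inter> D = {d}" using D unfolding discrete_in_def by blast
  have "U \<subseteq> topspace X" using U(1) by (rule openin_subset)
  then have "h ` U \<inter> h ` D = h ` (U \<inter> D)" using inj DX by (metis inj_on_image_Int)
  moreover have "openin Y (h ` U)" using h U(1) \<open>U \<subseteq> topspace X\<close>
    by (simp add: homeomorphic_map_openness)
  ultimately show "\<exists>U. openin Y U \<and> U \<inter> h ` D = {y}"
    using U(2) d(2) by (intro exI[of _ "h ` U"]) simp
qed

lemma Eberlein_compact_uncountable_discrete:
  assumes "Eberlein_compact TYPE('b::real_vector) X" "\<not> metrizable_space X"
  obtains D where "discrete_in X D" "uncountable D"
proof -
  obtain V :: "'b set" and N C where N: "banach_on V N" and C: "compactin (weak_topology_on V N) C"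
    and X: "X homeomorphic_space subtopology (weak_topology_on V N) C"
    using assms(1) unfolding Eberlein_compact_def by blast
  let ?W = "weak_topology_on V N"
  have "norm_on V N" using N by (simp add: banach_on_def)
  moreover have "\<not> metrizable_space (subtopology ?W C)"
    using assms(2) homeomorphic_metrizable_space[OF X] by simp
  ultimately obtain D where D: "D \<subseteq> C" "discrete_in ?W D" "uncountable D"
    using weakly_compact_countable_spread_metrizable[OF _ C] by blast
  obtain h where h: "homeomorphic_map (subtopology ?W C) X h"
    using X by (meson homeomorphic_space homeomorphic_space_sym)
  have disc: "discrete_in (subtopology ?W C) D"
    using D(2,1) by (rule discrete_in_subtopology)
  then have "D \<subseteq> topspace (subtopology ?W C)" by (simp only: discrete_in_def)
  moreover have "inj_on h (topspace (subtopology ?W C))"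
    using h by (simp only: homeomorphic_map_def)
  ultimately have "inj_on h D" using inj_on_subset by blast
  then have "uncountable (h ` D)"
    using D(3) by (simp add: countable_image_inj_eq)
  with discrete_in_homeomorphic_image[OF h disc] that show thesis by blast
qed

theorem theorem5p9:
  fixes K :: "nat \<Rightarrow> 'a topology"
  assumes "\<And>n. completely_regular_space (K n)" and "\<And>n. Hausdorff_space (K n)"
    and "\<And>n. Eberlein_compact TYPE('b::real_vector) (K n)"
    and "\<And>n. \<not> metrizable_space (K n)"
  shows "\<not> hereditarily_metacompact (product_topology K UNIV)"
proof -
  have "\<exists>D. discrete_in (K n) D \<and> uncountable D" for n
    using Eberlein_compact_uncountable_discrete[OF assms(3,4)] by metis
  then obtain D where "\<And>n. discrete_in (K n) (D n)" "\<And>n. uncountable (D n)" by metis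
  moreover have "compact_space (K n)" for n
    using assms(3)[of n] unfolding Eberlein_compact_def
    by (auto dest: homeomorphic_compact_space simp: compact_space_subtopology)
  moreover have "t1_space (K n)" for n
    using assms(2) by (rule Hausdorff_imp_t1_space)
  ultimately show ?thesis by (intro not_hereditarily_metacompact_product)
qed

end
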